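(* Let $\mu=p/q$ be a positive rational number, where $p,q$ are co-prime positive integers. Define the sets of equivalence classes $$\mathsf{D}_\mu=\bigcup_{i=1}^{\infty}\ \bigcup_{\substack{1\le j\le i\\ \gcd(i,j)=1}}\ \bigcup_{\substack{1\le k\le p\\ 1\le l\le q}}\left\{\left\langle E^{p\times q}_{kl}\otimes E^{i\times i}_{jj}\right\rangle\right\},$$ $$\mathsf{N}_\mu=\bigcup_{i=2}^{\infty}\ \bigcup_{\substack{1\le j_1,j_2\le i\\ j_1\ne j_2\\ \gcd(i,j_1,j_2)=1}}\ \bigcup_{\substack{1\le k\le p\\ 1\le l\le q}}\left\{\left\langle E^{p\times q}_{kl}\otimes E^{i\times i}_{j_1j_2}\right\rangle\right\}.$$ Then the countably infinite set $\mathsf{D}_\mu\cup\mathsf{N}_\mu$ is a basis of the real vector space $(\Sigma_\mu,\boxplus)$.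
   Context: All matrices are real. $\mathcal{M}_{m\times n}$ is the set of $m\times n$ real matrices ($m,n$ positive integers), $\otimes$ is the Kronecker product, $I_s$ is the $s\times s$ identity matrix, $\operatorname{lcm}$ is the least common multiple and $\gcd$ the greatest common divisor. For a positive rational number $\mu$, $\mathcal{M}_\mu$ is the set of all real matrices of size $m\times n$ with $m,n$ positive integers and $m/n=\mu$. Identity equivalence: two matrices $A,B$ satisfy $A\sim B$ if there exist positive integers $s,t$ with $A\otimes I_s=B\otimes I_t$. This is an equivalence relation; $\langle A\rangle$ denotes the class of $A$, and $\Sigma_\mu:=\mathcal{M}_\mu/\!\sim$. Semi-tensor addition (denoted $\boxplus$ here): for $A\in\mathcal{M}_{m\times n}$, $B\in\mathcal{M}_{r\times s}$ with $m/n=r/s=\mu$ and $t=\operatorname{lcm}(m,r)$, $A\boxplus B:=(A\otimes I_{t/m})+(B\otimes I_{t/r})$. The relation $\sim$ is a congruence for $\boxplus$, so $\langle A\rangle\boxplus\langle B\rangle:=\langle A\boxplus B\rangle$ is well defined on $\Sigma_\mu$. With this addition and the scalar multiplication $c\langle A\rangle:=\langle cA\rangle$ ($c\in\mathbb{R}$), $\Sigma_\mu$ is a real vector space. $E^{m\times n}_{ij}$ denotes the $m\times n$ matrix whose $(i,j)$ entry is $1$ and whose other entries are all $0$. A basis means a Hamel basis: a linearly independent set whose finite linear combinations give the whole space. *)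

theory Defs
  imports "Jordan_Normal_Form.VS_Connect" "HOL-Library.Countable_Set"
begin

definition kronecker :: "real mat \<Rightarrow> real mat \<Rightarrow> real mat" (infixl "\<otimes>\<^sub>K" 72) where
  "A \<otimes>\<^sub>K B =
     mat (dim_row A * dim_row B) (dim_col A * dim_col B)
       (\<lambda>(i, j). A $$ (i div dim_row B, j div dim_col B) * B $$ (i mod dim_row B, j mod dim_col B))"

text \<open>The indices \<open>i\<close>, \<open>j\<close> of the matrix unit are 1-based, whereas matrix entries
  are accessed with 0-based indices.\<close>

definition matrix_unit :: "nat \<Rightarrow> nat \<Rightarrow> nat \<Rightarrow> nat \<Rightarrow> real mat" where
  "matrix_unit m n i j = mat m n (\<lambda>(a, b). if a + 1 = i \<and> b + 1 = j then 1 else 0)"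

text \<open>The type \<^typ>\<open>real mat\<close> contains matrices with zero rows or columns; these are
  excluded here.\<close>

definition pos_mats :: "real mat set" where
  "pos_mats = {A. 0 < dim_row A \<and> 0 < dim_col A}"

definition mats_ratio :: "rat \<Rightarrow> real mat set" where
  "mats_ratio \<mu> = {A \<in> pos_mats. of_nat (dim_row A) / of_nat (dim_col A) = \<mu>}"

definition id_equiv :: "real mat rel" where
  "id_equiv = {(A, B). A \<in> pos_mats \<and> B \<in> pos_mats \<and>
     (\<exists>s t. 0 < s \<and> 0 < t \<and> A \<otimes>\<^sub>K 1\<^sub>m s = B \<otimes>\<^sub>K 1\<^sub>m t)}"

definition id_class :: "real mat \<Rightarrow> real mat set" where
  "id_class A = id_equiv `` {A}"

text \<open>Semi-tensor addition, meant for matrices with the same ratio of rows to columns;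
  then both summands have the same dimensions.\<close>

definition st_add :: "real mat \<Rightarrow> real mat \<Rightarrow> real mat" (infixl "\<boxplus>" 65) where
  "A \<boxplus> B =
     (let t = lcm (dim_row A) (dim_row B)
      in A \<otimes>\<^sub>K 1\<^sub>m (t div dim_row A) + B \<otimes>\<^sub>K 1\<^sub>m (t div dim_row B))"

text \<open>The operations on classes are written as unions over all representatives; as
  \<^const>\<open>id_equiv\<close> is a congruence, all members of the union coincide. The zero vector is
  the class of the zero matrix whose size is given by \<open>\<mu>\<close> in lowest terms. The fields
  \<^const>\<open>mult\<close> and \<^const>\<open>one\<close> of the record play no role for modules.\<close>

definition Sigma_space :: "rat \<Rightarrow> (real, real mat set) module" where
  "Sigma_space \<mu> = \<lparr>
     carrier = mats_ratio \<mu> // id_equiv,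
     mult = undefined,
     one = undefined,
     zero = (case quotient_of \<mu> of (p, q) \<Rightarrow> id_class (0\<^sub>m (nat p) (nat q))),
     add = (\<lambda>X Y. \<Union>A\<in>X. \<Union>B\<in>Y. id_class (A \<boxplus> B)),
     smult = (\<lambda>c X. \<Union>A\<in>X. id_class (c \<cdot>\<^sub>m A))\<rparr>"

definition D_set :: "nat \<Rightarrow> nat \<Rightarrow> real mat set set" where
  "D_set p q =
     {id_class (matrix_unit p q k l \<otimes>\<^sub>K matrix_unit i i j j) | i j k l.
        1 \<le> i \<and> 1 \<le> j \<and> j \<le> i \<and> gcd i j = 1 \<and>
        1 \<le> k \<and> k \<le> p \<and> 1 \<le> l \<and> l \<le> q}"

definition N_set :: "nat \<Rightarrow> nat \<Rightarrow> real mat set set" where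
  "N_set p q =
     {id_class (matrix_unit p q k l \<otimes>\<^sub>K matrix_unit i i j1 j2) | i j1 j2 k l.
        2 \<le> i \<and> 1 \<le> j1 \<and> j1 \<le> i \<and> 1 \<le> j2 \<and> j2 \<le> i \<and> j1 \<noteq> j2 \<and> gcd i (gcd j1 j2) = 1 \<and>
        1 \<le> k \<and> k \<le> p \<and> 1 \<le> l \<and> l \<le> q}"

end

theory Submission
  imports Defs
begin

text \<open>
  An \<open>m \<times> n\<close> matrix \<open>A\<close> cuts the unit square \<open>(0,1]\<^sup>2\<close> into \<open>m \<times> n\<close> cells. Let \<open>square_fun A\<close> be
  the function on the square that carries the value of an entry along the diagonal of its cell,
  without the diagonal's lower left end, and vanishes off these diagonals. In \<open>A \<otimes>\<^sub>K 1\<^sub>m s\<close>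
  every entry becomes an \<open>s \<times> s\<close> scalar block, which cuts its diagonal into \<open>s\<close> pieces and leaves
  the function unchanged (\<open>square_fun_kronecker_one\<close>). As the entries of a matrix can be read off
  at the upper right corners of the cells, two matrices of the same ratio are equivalent exactly
  when they have the same function (\<open>mem_id_class_iff\<close>). Semi-tensor addition and scaling become
  pointwise operations, so \<open>\<Sigma>\<^sub>\<mu>\<close> embeds linearly into the real functions on the square, and is a
  vector space.

  Under this embedding, the class of a matrix unit is the indicator of a half-open diagonal segment.
  The elements of \<open>D_set p q \<union> N_set p q\<close> are the units at position \<open>(a, b)\<close> of a
  \<open>p i \<times> q i\<close> matrix with \<open>gcd i (gcd a b) = 1\<close> (\<open>D_N_eq_unit_class\<close>): the segment of
  such a unit is the longest one with its upper right end, and every pair of rationals in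
  \<open>(0,1]\<^sup>2\<close> is the end of exactly one of them.

  Independence: two of these segments have different ends, and the end of one lies on
  another only if it comes strictly before the end of that other. So the system is triangular
  (\<open>lin_indpt_triangular\<close>): in a linear combination, the term whose end is
  rightmost is the only one that does not vanish there.

  Spanning: matrix units span all matrices. If \<open>s = gcd N (gcd a b)\<close>, the unit at \<open>(a, b)\<close> of a
  \<open>p N \<times> q N\<close> matrix is the last of \<open>s\<close> equal pieces of a primitive segment, the other pieces
  being the units at \<open>(a - r, b - r)\<close> with \<open>0 < r < s\<close>. These have a smaller row
  index, so induction on \<open>a\<close> applies (\<open>unit_class_mem_span\<close>).
\<close>

section \<open>Modules that embed into a space of functions\<close>

text \<open>An injection into functions that respects the operations transports the vector space axioms
  back to \<^term>\<open>V\<close>, and turns every linear identity in \<^term>\<open>V\<close> into a pointwise one. It replaces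
  calculations with sets of representatives in the quotient space.\<close>

locale function_model =
  fixes V :: "('k::field, 'v) module" and \<phi> :: "'v \<Rightarrow> 'x \<Rightarrow> 'k"
  assumes inj: "inj_on \<phi> (carrier V)"
    and zero_closed: "\<zero>\<^bsub>V\<^esub> \<in> carrier V"
    and add_closed: "\<And>u v. u \<in> carrier V \<Longrightarrow> v \<in> carrier V \<Longrightarrow> u \<oplus>\<^bsub>V\<^esub> v \<in> carrier V"
    and smult_closed: "\<And>c v. v \<in> carrier V \<Longrightarrow> c \<odot>\<^bsub>V\<^esub> v \<in> carrier V"
    and zero: "\<phi> \<zero>\<^bsub>V\<^esub> = (\<lambda>_. 0)"
    and add: "\<And>u v. u \<in> carrier V \<Longrightarrow> v \<in> carrier V \<Longrightarrow> \<phi> (u \<oplus>\<^bsub>V\<^esub> v) = (\<lambda>z. \<phi> u z + \<phi> v z)"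
    and smult: "\<And>c v. v \<in> carrier V \<Longrightarrow> \<phi> (c \<odot>\<^bsub>V\<^esub> v) = (\<lambda>z. c * \<phi> v z)"
begin

lemma eqI: "u \<in> carrier V \<Longrightarrow> v \<in> carrier V \<Longrightarrow> (\<And>z. \<phi> u z = \<phi> v z) \<Longrightarrow> u = v"
  using inj by (auto simp: inj_on_def fun_eq_iff)

lemma vectorspace: "vectorspace (class_ring :: 'k ring) V"
proof (rule vs_criteria)
  show "\<forall>v\<in>carrier V. \<exists>neg_v\<in>carrier V. v \<oplus>\<^bsub>V\<^esub> neg_v = \<zero>\<^bsub>V\<^esub>"
  proof
    fix v assume v: "v \<in> carrier V"
    show "\<exists>neg_v\<in>carrier V. v \<oplus>\<^bsub>V\<^esub> neg_v = \<zero>\<^bsub>V\<^esub>"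
      by (intro bexI[of _ "(-1) \<odot>\<^bsub>V\<^esub> v"] eqI)
        (simp_all add: v zero_closed add_closed smult_closed zero add smult)
  qed
qed (auto intro!: eqI class_field zero_closed add_closed smult_closed
      simp: zero add smult zero_closed add_closed smult_closed algebra_simps)

end

sublocale function_model \<subseteq> vectorspace "class_ring :: 'k ring" V
  by (rule vectorspace)

context function_model
begin

lemma lincomb_apply:
  assumes "finite A" "A \<subseteq> carrier V"
  shows "\<phi> (lincomb a A) z = (\<Sum>v\<in>A. a v * \<phi> v z)"
  using assms
proof (induction A rule: finite_induct)
  case empty
  then show ?case by (simp add: lincomb_def zero)
next
  case (insert v A)
  then have *: "lincomb a (A \<union> {v}) = (a v \<odot>\<^bsub>V\<^esub> v) \<oplus>\<^bsub>V\<^esub> lincomb a A"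
    by (intro lincomb_insert) auto
  have "lincomb a A \<in> carrier V"
    using insert by (intro lincomb_closed) auto
  with insert * show ?case
    by (simp add: add smult smult_closed)
qed

text \<open>Membership in a span can be checked on functions: the linear combination of the \<open>w j\<close>
  never has to be formed in \<^term>\<open>V\<close>.\<close>

lemma submodule_memI:
  assumes W: "submodule (class_ring :: 'k ring) W V" and "finite J"
    and "\<And>j. j \<in> J \<Longrightarrow> w j \<in> W"
    and v: "v \<in> carrier V" "\<And>z. \<phi> v z = (\<Sum>j\<in>J. c j * \<phi> (w j) z)"
  shows "v \<in> W"
proof -
  interpret W: submodule "class_ring :: 'k ring" W V by (rule W)
  have "\<exists>u\<in>W. \<forall>z. \<phi> u z = (\<Sum>j\<in>J. c j * \<phi> (w j) z)"
    using \<open>finite J\<close> assms(3)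
  proof (induction J rule: finite_induct)
    case empty
    then show ?case by (intro bexI[of _ "\<zero>\<^bsub>V\<^esub>"]) (simp_all add: zero)
  next
    case (insert j J)
    then obtain u where u: "u \<in> W" "\<forall>z. \<phi> u z = (\<Sum>j\<in>J. c j * \<phi> (w j) z)" by auto
    have "w j \<in> W" using insert by auto
    with insert u W.subset show ?case
      by (intro bexI[of _ "(c j \<odot>\<^bsub>V\<^esub> w j) \<oplus>\<^bsub>V\<^esub> u"])
        (auto simp: add smult smult_closed subset_iff)
  qed
  then obtain u where "u \<in> W" "\<And>z. \<phi> u z = \<phi> v z"
    using v(2) by auto
  then show ?thesis
    using eqI[of u v] W.subset v(1) by auto
qed

text \<open>The matrix of the values \<open>\<phi> (f j) (pt i)\<close> is triangular with nonzero diagonal. Evaluation at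
  the point of the vector of largest rank among those that occur in a relation leaves only that
  vector's term. The same argument shows that different indices give different vectors, as
  needed because bases are sets rather than families.\<close>

lemma lin_indpt_triangular:
  fixes rank :: "'i \<Rightarrow> 'b::linorder"
  assumes carrier: "f ` I \<subseteq> carrier V"
    and diag: "\<And>i. i \<in> I \<Longrightarrow> \<phi> (f i) (pt i) \<noteq> 0"
    and upper: "\<And>i j. i \<in> I \<Longrightarrow> j \<in> I \<Longrightarrow> \<phi> (f j) (pt i) \<noteq> 0 \<Longrightarrow> i = j \<or> rank i < rank j"
  shows "inj_on f I" and "lin_indpt (f ` I)"
proof -
  show inj_f: "inj_on f I"
    using diag upper by (metis inj_onI less_asym)
  show "lin_indpt (f ` I)"
  proof
    assume "lin_dep (f ` I)"
    then obtain A a v where A: "finite A" "A \<subseteq> f ` I" "lincomb a A = \<zero>\<^bsub>V\<^esub>" "v \<in> A" "a v \<noteq> 0"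
      by (auto simp: lin_dep_def)
    then obtain J where J: "J \<subseteq> I" "A = f ` J" "inj_on f J"
      by (meson subset_image_inj)
    define K where "K = {j \<in> J. a (f j) \<noteq> 0}"
    have "finite J" using A J finite_imageD by blast
    then have "finite K" "K \<noteq> {}" using A J by (auto simp: K_def)
    then have "Max (rank ` K) \<in> rank ` K" by simp
    then obtain i where "i \<in> K" "Max (rank ` K) = rank i" by auto
    then have i: "i \<in> K" "\<And>j. j \<in> K \<Longrightarrow> rank j \<le> rank i"
      using Max_ge[OF finite_imageI[OF \<open>finite K\<close>]] by (metis, metis imageI)
    have zero_term: "a (f j) * \<phi> (f j) (pt i) = 0" if "j \<in> J" "j \<noteq> i" for j
      using i that J upper[of i j] by (fastforce simp: K_def)
    have "0 = \<phi> (lincomb a A) (pt i)" using A by (simp add: zero)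
    also have "\<dots> = (\<Sum>v\<in>A. a v * \<phi> v (pt i))"
      using A carrier by (intro lincomb_apply) auto
    also have "\<dots> = (\<Sum>j\<in>J. a (f j) * \<phi> (f j) (pt i))"
      using J by (simp add: sum.reindex)
    also have "\<dots> = (\<Sum>j\<in>{i}. a (f j) * \<phi> (f j) (pt i))"
      using i zero_term \<open>finite J\<close> by (intro sum.mono_neutral_right) (auto simp: K_def)
    finally show False
      using i diag[of i] J by (auto simp: K_def)
  qed
qed

end

section \<open>Matrices as functions on the unit square\<close>

text \<open>For \<open>0 < x \<le> 1\<close>, the number \<open>x n\<close> is split into a 0-based cell index in \<open>{..<n}\<close> and an
  offset in \<open>(0,1]\<close>. Cells are closed at the right, so that a 1-based index \<open>a\<close> corresponds to the
  end \<open>a / n\<close> of its cell; the gcd conditions on the basis speak of these ends.\<close>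

definition cell :: "nat \<Rightarrow> real \<Rightarrow> nat" where
  "cell n x = nat \<lceil>x * real n\<rceil> - 1"

definition offset :: "nat \<Rightarrow> real \<Rightarrow> real" where
  "offset n x = x * real n - real (cell n x)"

definition square_fun :: "real mat \<Rightarrow> real \<times> real \<Rightarrow> real" where
  "square_fun A = (\<lambda>(x, y).
     if 0 < x \<and> x \<le> 1 \<and> 0 < y \<and> y \<le> 1 \<and> offset (dim_row A) x = offset (dim_col A) y
     then A $$ (cell (dim_row A) x, cell (dim_col A) y) else 0)"

lemma cell_offset_eqI:
  assumes "x * real n = real a + w" "0 < w" "w \<le> 1"
  shows "cell n x = a" and "offset n x = w"
proof -
  have "\<lceil>x * real n\<rceil> = int a + 1"
    using assms by (intro ceiling_unique) auto
  then show "cell n x = a" by (simp add: cell_def)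
  then show "offset n x = w" using assms by (simp add: offset_def)
qed

lemma cell_offset:
  assumes "0 < n" "0 < x"
  shows "x * real n = real (cell n x) + offset n x" "0 < offset n x" "offset n x \<le> 1"
proof -
  have pos: "0 < x * real n" using assms by simp
  then have "1 \<le> \<lceil>x * real n\<rceil>" by linarith
  then have "int (cell n x) = \<lceil>x * real n\<rceil> - 1"
    unfolding cell_def by linarith
  then have "real (cell n x) = of_int \<lceil>x * real n\<rceil> - 1" by linarith
  then show "x * real n = real (cell n x) + offset n x" "0 < offset n x" "offset n x \<le> 1"
    unfolding offset_def by linarith+
qed

lemma cell_less:
  assumes "0 < n" "0 < x" "x \<le> 1"
  shows "cell n x < n"
proof -
  have "x * real n \<le> real n" using assms by (simp add: mult_left_le_one_le)
  then have "real (cell n x) < real n" using cell_offset[OF assms(1,2)] by linarith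
  then show ?thesis by simp
qed

text \<open>Refining each of \<open>n\<close> cells into \<open>s\<close> cells amounts to splitting the offset again.\<close>

lemma cell_offset_mult:
  assumes "0 < n" "0 < s" "0 < x"
  shows "cell (n * s) x = cell n x * s + cell s (offset n x)"
    and "offset (n * s) x = offset s (offset n x)"
proof -
  note c = cell_offset[OF assms(1,3)]
  note c' = cell_offset[OF assms(2) c(2)]
  have "x * real (n * s) = (x * real n) * real s" by simp
  also have "\<dots> = real (cell n x * s) + offset n x * real s"
    by (subst c(1)) (simp add: algebra_simps)
  finally have "x * real (n * s) = real (cell n x * s + cell s (offset n x)) + offset s (offset n x)"
    using c'(1) by simp
  from cell_offset_eqI[OF this c'(2,3)]
  show "cell (n * s) x = cell n x * s + cell s (offset n x)"
    and "offset (n * s) x = offset s (offset n x)" by auto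
qed

lemma cell_offset_grid:
  assumes "0 < n"
  shows "cell n (real (Suc a) / real n) = a" and "offset n (real (Suc a) / real n) = 1"
  using cell_offset_eqI[of "real (Suc a) / real n" n a 1] assms by auto

lemma dim_kronecker [simp]:
  "dim_row (A \<otimes>\<^sub>K B) = dim_row A * dim_row B" "dim_col (A \<otimes>\<^sub>K B) = dim_col A * dim_col B"
  by (simp_all add: kronecker_def)

lemma div_mod_less_mult:
  fixes i m s :: nat
  assumes "i < m * s"
  shows "i div s < m" "i mod s < s"
  using assms by (auto simp: less_mult_imp_div_less intro!: mod_less_divisor gr0I)

lemma kronecker_one_index:
  assumes "i < dim_row A * s" "j < dim_col A * s"
  shows "(A \<otimes>\<^sub>K 1\<^sub>m s) $$ (i, j) = (if i mod s = j mod s then A $$ (i div s, j div s) else 0)"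
  using assms div_mod_less_mult[OF assms(1)] div_mod_less_mult[OF assms(2)]
  by (simp add: kronecker_def)

text \<open>Two points in the same relative position of a coarse cell have equal fine offsets and equal
  fine cells within it, and the latter is the diagonal condition of the identity matrix.\<close>

lemma square_fun_kronecker_one:
  assumes "0 < dim_row A" "0 < dim_col A" "0 < s"
  shows "square_fun (A \<otimes>\<^sub>K 1\<^sub>m s) = square_fun A"
proof (intro ext, safe)
  fix x y
  let ?m = "dim_row A" and ?n = "dim_col A"
  show "square_fun (A \<otimes>\<^sub>K 1\<^sub>m s) (x, y) = square_fun A (x, y)"
  proof (cases "0 < x \<and> x \<le> 1 \<and> 0 < y \<and> y \<le> 1")
    case True
    let ?u = "offset ?m x" and ?v = "offset ?n y"
    have u: "0 < ?u" "?u \<le> 1" "0 < ?v" "?v \<le> 1"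
      using cell_offset[of ?m x] cell_offset[of ?n y] True assms by auto
    have cs: "cell s ?u < s" "cell s ?v < s"
      using u assms by (auto intro: cell_less)
    have lt: "cell ?m x * s + cell s ?u < ?m * s" "cell ?n y * s + cell s ?v < ?n * s"
      using cell_less[of "?m * s" x] cell_less[of "?n * s" y] True assms
        cell_offset_mult[of ?m s x] cell_offset_mult[of ?n s y] by auto
    have iff: "?u = ?v \<longleftrightarrow> offset s ?u = offset s ?v \<and> cell s ?u = cell s ?v"
      using cell_offset(1)[of s ?u] cell_offset(1)[of s ?v] u assms
      by (metis mult_right_cancel of_nat_0_eq_iff less_irrefl)
    have "square_fun (A \<otimes>\<^sub>K 1\<^sub>m s) (x, y) =
      (if offset s ?u = offset s ?v \<and> cell s ?u = cell s ?v then A $$ (cell ?m x, cell ?n y) else 0)"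
      using True assms cs lt
      by (simp add: square_fun_def cell_offset_mult kronecker_one_index)
    then show ?thesis
      using True by (simp add: square_fun_def flip: iff)
  qed (auto simp: square_fun_def)
qed

text \<open>At the upper right corner of a cell both offsets are \<open>1\<close>, so the value there is the entry.\<close>

lemma square_fun_inj:
  assumes "dim_row A = dim_row B" "dim_col A = dim_col B" "square_fun A = square_fun B"
  shows "A = B"
proof (rule eq_matI)
  fix i j assume ij: "i < dim_row B" "j < dim_col B"
  let ?z = "(real (Suc i) / real (dim_row B), real (Suc j) / real (dim_col B))"
  have "square_fun M ?z = M $$ (i, j)"
    if "dim_row M = dim_row B" "dim_col M = dim_col B" for M
    using ij that
    by (auto simp: square_fun_def cell_offset_grid simp del: of_nat_Suc)
  with assms show "A $$ (i, j) = B $$ (i, j)" by metis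
qed (use assms in auto)

text \<open>Among matrices of one size, the value at a point is either the same entry of all of them or
  \<open>0\<close> for all of them. Hence the operations on matrices are pointwise on functions.\<close>

lemma square_fun_sum:
  assumes pos: "0 < dim_row A" "0 < dim_col A"
    and dim: "\<And>r. r \<in> R \<Longrightarrow> dim_row (B r) = dim_row A" "\<And>r. r \<in> R \<Longrightarrow> dim_col (B r) = dim_col A"
    and entry: "\<And>i j. i < dim_row A \<Longrightarrow> j < dim_col A \<Longrightarrow>
      A $$ (i, j) = (\<Sum>r\<in>R. c r * B r $$ (i, j))"
  shows "square_fun A z = (\<Sum>r\<in>R. c r * square_fun (B r) z)"
  using pos dim entry
  by (cases z) (auto simp: square_fun_def cell_less intro!: sum.cong)

lemma square_fun_add:
  assumes "0 < dim_row A" "0 < dim_col A" "dim_row B = dim_row A" "dim_col B = dim_col A"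
  shows "square_fun (A + B) z = square_fun A z + square_fun B z"
  using assms by (cases z) (auto simp: square_fun_def cell_less)

lemma square_fun_smult:
  assumes "0 < dim_row A" "0 < dim_col A"
  shows "square_fun (c \<cdot>\<^sub>m A) z = c * square_fun A z"
  using assms by (cases z) (auto simp: square_fun_def cell_less)

lemma square_fun_zero:
  assumes "0 < m" "0 < n"
  shows "square_fun (0\<^sub>m m n) = (\<lambda>_. 0)"
  using assms by (auto simp: square_fun_def cell_less fun_eq_iff)

section \<open>Identity equivalence and the space of classes\<close>

lemma mats_ratio_cross:
  assumes "A \<in> mats_ratio \<mu>" "B \<in> mats_ratio \<mu>"
  shows "dim_row A * dim_col B = dim_row B * dim_col A"
proof -
  have "rat_of_nat (dim_row A) / of_nat (dim_col A) = of_nat (dim_row B) / of_nat (dim_col B)"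
    "0 < dim_col A" "0 < dim_col B"
    using assms by (auto simp: mats_ratio_def pos_mats_def)
  then have "rat_of_nat (dim_row A * dim_col B) = rat_of_nat (dim_row B * dim_col A)"
    by (simp add: frac_eq_eq)
  then show ?thesis by (simp only: of_nat_eq_iff)
qed

lemma mats_ratio_transfer:
  assumes "A \<in> mats_ratio \<mu>" "B \<in> pos_mats" "dim_row A * dim_col B = dim_row B * dim_col A"
  shows "B \<in> mats_ratio \<mu>"
proof -
  have "rat_of_nat (dim_row A * dim_col B) = rat_of_nat (dim_row B * dim_col A)"
    using assms by simp
  then show ?thesis
    using assms by (auto simp: mats_ratio_def pos_mats_def field_simps)
qed

lemma mats_ratio_pos:
  assumes "A \<in> mats_ratio \<mu>"
  shows "A \<in> pos_mats" "0 < dim_row A" "0 < dim_col A"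
  using assms by (auto simp: mats_ratio_def pos_mats_def)

text \<open>For the converse direction, \<open>A \<otimes>\<^sub>K 1\<^sub>m (dim_row B)\<close> and \<open>B \<otimes>\<^sub>K 1\<^sub>m (dim_row A)\<close> have the same
  number of rows, hence by the common ratio the same size, and there the function determines
  the matrix.\<close>

lemma mem_id_class_iff:
  assumes A: "A \<in> mats_ratio \<mu>"
  shows "B \<in> id_class A \<longleftrightarrow> B \<in> mats_ratio \<mu> \<and> square_fun B = square_fun A"
proof
  assume "B \<in> id_class A"
  then obtain s t where B: "B \<in> pos_mats" and st: "0 < s" "0 < t" "A \<otimes>\<^sub>K 1\<^sub>m s = B \<otimes>\<^sub>K 1\<^sub>m t"
    by (auto simp: id_class_def id_equiv_def)
  have "dim_row A * s = dim_row B * t" "dim_col A * s = dim_col B * t"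
    using arg_cong[OF st(3), of dim_row] arg_cong[OF st(3), of dim_col] by auto
  then have "dim_row A * dim_col B * (s * t) = dim_row B * dim_col A * (s * t)"
    by (metis mult.assoc mult.commute)
  then have "dim_row A * dim_col B = dim_row B * dim_col A" using st by simp
  with A B have "B \<in> mats_ratio \<mu>" by (rule mats_ratio_transfer)
  moreover have "square_fun B = square_fun A"
    using square_fun_kronecker_one[of A s] square_fun_kronecker_one[of B t] st
      mats_ratio_pos[OF A] mats_ratio_pos[OF calculation] by simp
  ultimately show "B \<in> mats_ratio \<mu> \<and> square_fun B = square_fun A" ..
next
  assume B: "B \<in> mats_ratio \<mu> \<and> square_fun B = square_fun A"
  note pos = mats_ratio_pos[OF A] mats_ratio_pos[of B \<mu>]
  have "A \<otimes>\<^sub>K 1\<^sub>m (dim_row B) = B \<otimes>\<^sub>K 1\<^sub>m (dim_row A)"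
    using mats_ratio_cross[OF A, of B] B pos
    by (intro square_fun_inj) (auto simp: square_fun_kronecker_one mult.commute)
  with pos B show "B \<in> id_class A"
    by (auto simp: id_class_def id_equiv_def)
qed

lemma id_class_eq_iff:
  assumes "A \<in> mats_ratio \<mu>" "B \<in> mats_ratio \<mu>"
  shows "id_class A = id_class B \<longleftrightarrow> square_fun A = square_fun B"
proof
  assume "id_class A = id_class B"
  moreover have "A \<in> id_class A" using assms(1) by (simp add: mem_id_class_iff[OF assms(1)])
  ultimately have "A \<in> id_class B" by simp
  then show "square_fun A = square_fun B" by (simp add: mem_id_class_iff[OF assms(2)])
next
  assume "square_fun A = square_fun B"
  then show "id_class A = id_class B"
    by (auto simp: mem_id_class_iff[OF assms(1)] mem_id_class_iff[OF assms(2)])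
qed

lemma st_add_mats_ratio:
  assumes A: "A \<in> mats_ratio \<mu>" and B: "B \<in> mats_ratio \<mu>"
  shows "A \<boxplus> B \<in> mats_ratio \<mu>"
    and "square_fun (A \<boxplus> B) z = square_fun A z + square_fun B z"
proof -
  let ?m = "dim_row A" and ?r = "dim_row B"
  define t where "t = lcm ?m ?r"
  note pos = mats_ratio_pos[OF A] mats_ratio_pos[OF B]
  have "0 < t" using pos by (simp add: t_def lcm_pos_nat)
  have t: "?m * (t div ?m) = t" "?r * (t div ?r) = t" by (simp_all add: t_def)
  then have d: "0 < t div ?m" "0 < t div ?r" using \<open>0 < t\<close> by (metis gr0I mult_0_right)+
  have "(?m * ?r) * (dim_col A * (t div ?m)) = (?m * ?r) * (dim_col B * (t div ?r))"
    using mats_ratio_cross[OF A B] t by (metis mult.assoc mult.commute)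
  then have cols: "dim_col A * (t div ?m) = dim_col B * (t div ?r)" using pos by simp
  have sum: "A \<boxplus> B = A \<otimes>\<^sub>K 1\<^sub>m (t div ?m) + B \<otimes>\<^sub>K 1\<^sub>m (t div ?r)"
    by (simp add: st_add_def t_def Let_def)
  have dims: "dim_row (A \<boxplus> B) = ?m * (t div ?m)" "dim_col (A \<boxplus> B) = dim_col A * (t div ?m)"
    by (simp_all add: sum t cols)
  show "A \<boxplus> B \<in> mats_ratio \<mu>"
    using pos d \<open>0 < t\<close> by (intro mats_ratio_transfer[OF A]) (auto simp: pos_mats_def dims)
  show "square_fun (A \<boxplus> B) z = square_fun A z + square_fun B z"
    unfolding sum using pos d t cols \<open>0 < t\<close>
    by (subst square_fun_add) (simp_all add: square_fun_kronecker_one)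
qed

lemma smult_mats_ratio:
  "A \<in> mats_ratio \<mu> \<Longrightarrow> c \<cdot>\<^sub>m A \<in> mats_ratio \<mu>"
  by (simp add: mats_ratio_def pos_mats_def)

text \<open>All representatives of a class of \<open>\<Sigma>\<^sub>\<mu>\<close> have the same function, so the choice is
  immaterial.\<close>

definition class_fun :: "real mat set \<Rightarrow> real \<times> real \<Rightarrow> real" where
  "class_fun X = square_fun (SOME A. A \<in> X)"

lemma class_fun_id_class:
  assumes "A \<in> mats_ratio \<mu>"
  shows "class_fun (id_class A) = square_fun A"
proof -
  have "A \<in> id_class A" using assms by (simp add: mem_id_class_iff[OF assms])
  then have "(SOME B. B \<in> id_class A) \<in> id_class A" by (rule someI)
  then show ?thesis by (simp add: class_fun_def mem_id_class_iff[OF assms])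
qed

lemma carrier_Sigma_space: "carrier (Sigma_space \<mu>) = id_class ` mats_ratio \<mu>"
  by (auto simp: Sigma_space_def quotient_def id_class_def)

lemma add_Sigma_space:
  assumes A: "A \<in> mats_ratio \<mu>" and B: "B \<in> mats_ratio \<mu>"
  shows "id_class A \<oplus>\<^bsub>Sigma_space \<mu>\<^esub> id_class B = id_class (A \<boxplus> B)"
proof -
  have "id_class (A' \<boxplus> B') = id_class (A \<boxplus> B)" if "A' \<in> id_class A" "B' \<in> id_class B" for A' B'
    using that A B
    by (simp add: mem_id_class_iff[OF A] mem_id_class_iff[OF B] id_class_eq_iff[of _ \<mu>]
        st_add_mats_ratio[of _ \<mu>] fun_eq_iff)
  moreover have "id_class A \<noteq> {}" "id_class B \<noteq> {}"
    using mem_id_class_iff[OF A] mem_id_class_iff[OF B] A B by auto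
  ultimately have "(\<Union>A'\<in>id_class A. \<Union>B'\<in>id_class B. id_class (A' \<boxplus> B')) = id_class (A \<boxplus> B)"
    by (intro SUP_eq_const) simp_all
  then show ?thesis by (simp add: Sigma_space_def)
qed

lemma smult_Sigma_space:
  assumes A: "A \<in> mats_ratio \<mu>"
  shows "c \<odot>\<^bsub>Sigma_space \<mu>\<^esub> id_class A = id_class (c \<cdot>\<^sub>m A)"
proof -
  have "id_class (c \<cdot>\<^sub>m A') = id_class (c \<cdot>\<^sub>m A)" if "A' \<in> id_class A" for A'
  proof -
    have A': "A' \<in> mats_ratio \<mu>" "square_fun A' = square_fun A"
      using that by (simp_all add: mem_id_class_iff[OF A])
    have "square_fun (c \<cdot>\<^sub>m A') = square_fun (c \<cdot>\<^sub>m A)"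
      using A'(2) mats_ratio_pos[OF A] mats_ratio_pos[OF A'(1)]
      by (intro ext) (simp add: square_fun_smult)
    then show ?thesis
      using smult_mats_ratio[OF A'(1), of c] smult_mats_ratio[OF A, of c]
      by (simp add: id_class_eq_iff[of _ \<mu>])
  qed
  moreover have "id_class A \<noteq> {}"
    using mem_id_class_iff[OF A] A by auto
  ultimately have "(\<Union>A'\<in>id_class A. id_class (c \<cdot>\<^sub>m A')) = id_class (c \<cdot>\<^sub>m A)"
    by (intro SUP_eq_const)
  then show ?thesis by (simp add: Sigma_space_def)
qed

lemma mats_ratioI:
  assumes "0 < p" "0 < q" "0 < N" "dim_row A = p * N" "dim_col A = q * N"
  shows "A \<in> mats_ratio (of_nat p / of_nat q)"
  using assms by (simp add: mats_ratio_def pos_mats_def)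

lemma zero_Sigma_space:
  assumes "0 < q" "coprime p q"
  shows "\<zero>\<^bsub>Sigma_space (of_nat p / of_nat q)\<^esub> = id_class (0\<^sub>m p q)"
proof -
  have "rat_of_nat p / of_nat q = Rat.Fract (int p) (int q)"
    by (simp add: Fract_of_int_quotient)
  then have "quotient_of (rat_of_nat p / of_nat q) = (int p, int q)"
    using assms by (simp add: quotient_of_Fract)
  then show ?thesis by (simp add: Sigma_space_def)
qed

lemma function_model_Sigma_space:
  assumes "0 < p" "0 < q" "coprime p q"
  shows "function_model (Sigma_space (of_nat p / of_nat q)) class_fun"
proof -
  let ?\<mu> = "rat_of_nat p / of_nat q"
  have zero: "0\<^sub>m p q \<in> mats_ratio ?\<mu>"
    using assms by (intro mats_ratioI[of _ _ 1]) auto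
  show ?thesis
  proof
    show "inj_on class_fun (carrier (Sigma_space ?\<mu>))"
      by (auto simp: inj_on_def carrier_Sigma_space class_fun_id_class id_class_eq_iff)
    show "\<zero>\<^bsub>Sigma_space ?\<mu>\<^esub> \<in> carrier (Sigma_space ?\<mu>)"
      "class_fun \<zero>\<^bsub>Sigma_space ?\<mu>\<^esub> = (\<lambda>_. 0)"
      using zero assms
      by (simp_all add: carrier_Sigma_space zero_Sigma_space class_fun_id_class square_fun_zero)
  next
    fix u v assume "u \<in> carrier (Sigma_space ?\<mu>)" "v \<in> carrier (Sigma_space ?\<mu>)"
    then obtain A B where AB: "A \<in> mats_ratio ?\<mu>" "B \<in> mats_ratio ?\<mu>"
      and uv: "u = id_class A" "v = id_class B"
      by (auto simp: carrier_Sigma_space)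
    show "u \<oplus>\<^bsub>Sigma_space ?\<mu>\<^esub> v \<in> carrier (Sigma_space ?\<mu>)"
      using st_add_mats_ratio(1)[OF AB] AB by (simp add: uv add_Sigma_space carrier_Sigma_space)
    show "class_fun (u \<oplus>\<^bsub>Sigma_space ?\<mu>\<^esub> v) = (\<lambda>z. class_fun u z + class_fun v z)"
      using AB st_add_mats_ratio[OF AB]
      by (simp add: uv add_Sigma_space class_fun_id_class[of _ ?\<mu>] fun_eq_iff)
  next
    fix c v assume "v \<in> carrier (Sigma_space ?\<mu>)"
    then obtain A where A: "A \<in> mats_ratio ?\<mu>" and v: "v = id_class A"
      by (auto simp: carrier_Sigma_space)
    show "c \<odot>\<^bsub>Sigma_space ?\<mu>\<^esub> v \<in> carrier (Sigma_space ?\<mu>)"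
      using smult_mats_ratio[OF A] A by (simp add: v smult_Sigma_space carrier_Sigma_space)
    show "class_fun (c \<odot>\<^bsub>Sigma_space ?\<mu>\<^esub> v) = (\<lambda>z. c * class_fun v z)"
      using smult_mats_ratio[OF A] A mats_ratio_pos[OF A]
      by (simp add: v smult_Sigma_space class_fun_id_class[of _ ?\<mu>] square_fun_smult fun_eq_iff)
  qed
qed

section \<open>Matrix units\<close>

lemma dim_matrix_unit [simp]:
  "dim_row (matrix_unit m n a b) = m" "dim_col (matrix_unit m n a b) = n"
  by (simp_all add: matrix_unit_def)

lemma matrix_unit_index [simp]:
  "i < m \<Longrightarrow> j < n \<Longrightarrow>
    matrix_unit m n a b $$ (i, j) = (if i + 1 = a \<and> j + 1 = b then 1 else 0)"
  by (simp add: matrix_unit_def)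

lemma div_mod_eq_iff:
  fixes c s :: nat
  assumes "d < s"
  shows "c div s = a \<and> c mod s = d \<longleftrightarrow> c = a * s + d"
  using assms by auto

lemma div_mod_eq_iff_one_based:
  fixes a i j k :: nat
  assumes "1 \<le> k" "1 \<le> j" "j \<le> i"
  shows "a div i + 1 = k \<and> a mod i + 1 = j \<longleftrightarrow> a + 1 = (k - 1) * i + j"
proof -
  obtain k' j' where "k = Suc k'" "j = Suc j'"
    using assms by (metis Suc_le_D One_nat_def)
  then show ?thesis using assms div_mod_eq_iff[of j' i a k'] by simp
qed

lemma kronecker_matrix_unit:
  assumes "1 \<le> k" "1 \<le> l" "1 \<le> j1" "j1 \<le> i" "1 \<le> j2" "j2 \<le> i"
  shows "matrix_unit p q k l \<otimes>\<^sub>K matrix_unit i i j1 j2 =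
    matrix_unit (p * i) (q * i) ((k - 1) * i + j1) ((l - 1) * i + j2)"
proof (rule eq_matI)
  fix a b
  assume "a < dim_row (matrix_unit (p * i) (q * i) ((k - 1) * i + j1) ((l - 1) * i + j2))"
    "b < dim_col (matrix_unit (p * i) (q * i) ((k - 1) * i + j1) ((l - 1) * i + j2))"
  then have ab: "a < p * i" "b < q * i" by simp_all
  have "a div i + 1 = k \<and> a mod i + 1 = j1 \<longleftrightarrow> a + 1 = (k - 1) * i + j1"
    "b div i + 1 = l \<and> b mod i + 1 = j2 \<longleftrightarrow> b + 1 = (l - 1) * i + j2"
    using assms by (simp_all only: div_mod_eq_iff_one_based)
  moreover note div_mod_less_mult[OF ab(1)] div_mod_less_mult[OF ab(2)]
  ultimately show "(matrix_unit p q k l \<otimes>\<^sub>K matrix_unit i i j1 j2) $$ (a, b) =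
    matrix_unit (p * i) (q * i) ((k - 1) * i + j1) ((l - 1) * i + j2) $$ (a, b)"
    using ab by (auto simp: kronecker_def)
qed simp_all

lemma square_fun_matrix_unit_corner:
  assumes "1 \<le> a" "a \<le> m" "1 \<le> b" "b \<le> n"
  shows "square_fun (matrix_unit m n a b) (real a / real m, real b / real n) = 1"
proof -
  obtain a' b' where ab: "a = Suc a'" "b = Suc b'"
    using assms by (metis Suc_le_D One_nat_def)
  show ?thesis
    using assms unfolding ab by (auto simp: square_fun_def cell_offset_grid simp del: of_nat_Suc)
qed

text \<open>The segment of a matrix unit runs up to the right, so its end is its only point with the
  largest abscissa.\<close>

lemma square_fun_matrix_unit_nonzero:
  assumes "0 < m" "0 < n" "square_fun (matrix_unit m n a b) (x, y) \<noteq> 0"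
  shows "x < real a / real m \<or> x = real a / real m \<and> y = real b / real n"
proof -
  have xy: "0 < x" "x \<le> 1" "0 < y" "y \<le> 1" and off: "offset m x = offset n y"
    using assms(3) by (auto simp: square_fun_def split: if_splits)
  then have cells: "cell m x + 1 = a" "cell n y + 1 = b"
    using assms by (auto simp: square_fun_def cell_less split: if_splits)
  then have "x * real m = real a - 1 + offset m x" "y * real n = real b - 1 + offset m x"
    "offset m x \<le> 1"
    using cell_offset[of m x] cell_offset[of n y] xy assms(1,2) off by auto
  then have "x * real m < real a \<or> x * real m = real a \<and> y * real n = real b" by linarith
  then show ?thesis using assms(1,2) by (simp add: field_simps)
qed

text \<open>The diagonal of a cell, cut into \<open>s\<close> pieces and listed from its end backwards.\<close>

lemma square_fun_matrix_unit_refine: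
  assumes "0 < m" "0 < n" "0 < s" "1 \<le> a" "1 \<le> b"
  shows "square_fun (matrix_unit m n a b) z =
    (\<Sum>r<s. square_fun (matrix_unit (m * s) (n * s) (a * s - r) (b * s - r)) z)"
proof -
  let ?B = "\<lambda>r. matrix_unit (m * s) (n * s) (a * s - r) (b * s - r)"
  let ?A = "matrix_unit m n a b \<otimes>\<^sub>K 1\<^sub>m s"
  obtain a' b' where ab: "a = Suc a'" "b = Suc b'"
    using assms by (metis Suc_le_D One_nat_def)
  have "square_fun (matrix_unit m n a b) z = square_fun ?A z"
    using assms by (simp add: square_fun_kronecker_one)
  also have "\<dots> = (\<Sum>r<s. 1 * square_fun (?B r) z)"
  proof (rule square_fun_sum)
    fix i j assume "i < dim_row ?A" "j < dim_col ?A"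
    then have ij: "i < m * s" "j < n * s" by simp_all
    note dm = div_mod_less_mult[OF ij(1)] div_mod_less_mult[OF ij(2)]
    \<comment> \<open>at most one piece \<open>r\<close> covers \<open>(i, j)\<close>, as \<open>i\<close> determines \<open>r\<close>\<close>
    have *: "i + 1 = a * s - r \<and> j + 1 = b * s - r \<longleftrightarrow>
      r = s - 1 - i mod s \<and> i div s + 1 = a \<and> j div s + 1 = b \<and> i mod s = j mod s"
      if "r < s" for r
    proof -
      have "i + 1 = a * s - r \<longleftrightarrow> i = a' * s + (s - 1 - r)"
        "j + 1 = b * s - r \<longleftrightarrow> j = b' * s + (s - 1 - r)"
        using that by (auto simp: ab)
      then have "i + 1 = a * s - r \<longleftrightarrow> i div s = a' \<and> i mod s = s - 1 - r"
        "j + 1 = b * s - r \<longleftrightarrow> j div s = b' \<and> j mod s = s - 1 - r"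
        using div_mod_eq_iff[of "s - 1 - r" s i a'] div_mod_eq_iff[of "s - 1 - r" s j b'] that
        by simp_all
      moreover have "i mod s = s - 1 - r \<longleftrightarrow> r = s - 1 - i mod s"
        using that dm by linarith
      ultimately show ?thesis by (simp only: ab Suc_eq_plus1 add_right_cancel) metis
    qed
    have "(\<Sum>r<s. 1 * ?B r $$ (i, j)) =
      (\<Sum>r<s. if r = s - 1 - i mod s
        then if i div s + 1 = a \<and> j div s + 1 = b \<and> i mod s = j mod s then 1 else 0 else 0)"
      using ij * by (intro sum.cong) auto
    also have "\<dots> = (if i div s + 1 = a \<and> j div s + 1 = b \<and> i mod s = j mod s then 1 else 0)"
      using assms by (subst sum.delta) auto
    also have "\<dots> = ?A $$ (i, j)"
      using ij dm by (simp add: kronecker_one_index)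
    finally show "?A $$ (i, j) = (\<Sum>r<s. 1 * ?B r $$ (i, j))" ..
  qed (use assms in auto)
  finally show ?thesis by simp
qed

lemma square_fun_matrix_units:
  assumes "0 < dim_row A" "0 < dim_col A"
  shows "square_fun A z = (\<Sum>(i, j)\<in>{..<dim_row A} \<times> {..<dim_col A}.
    A $$ (i, j) * square_fun (matrix_unit (dim_row A) (dim_col A) (i + 1) (j + 1)) z)"
proof -
  have "square_fun A z = (\<Sum>r\<in>{..<dim_row A} \<times> {..<dim_col A}.
    A $$ r * square_fun (matrix_unit (dim_row A) (dim_col A) (fst r + 1) (snd r + 1)) z)"
  proof (rule square_fun_sum)
    fix i j assume ij: "i < dim_row A" "j < dim_col A"
    have "(\<Sum>r\<in>{..<dim_row A} \<times> {..<dim_col A}.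
        A $$ r * matrix_unit (dim_row A) (dim_col A) (fst r + 1) (snd r + 1) $$ (i, j)) =
      (\<Sum>r\<in>{..<dim_row A} \<times> {..<dim_col A}. if r = (i, j) then A $$ (i, j) else 0)"
      using ij by (intro sum.cong) auto
    then show "A $$ (i, j) = (\<Sum>r\<in>{..<dim_row A} \<times> {..<dim_col A}.
        A $$ r * matrix_unit (dim_row A) (dim_col A) (fst r + 1) (snd r + 1) $$ (i, j))"
      using ij by simp
  qed (use assms in auto)
  then show ?thesis by (simp add: case_prod_unfold)
qed

section \<open>The primitive matrix units form a basis\<close>

text \<open>The triple \<open>(i, a, b)\<close> stands for the point \<open>(a / (p i), b / (q i))\<close>, and the gcd
  condition says that \<open>i\<close> is the least common denominator of \<open>a / i\<close> and \<open>b / i\<close>.\<close>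

definition primitive_index :: "nat \<Rightarrow> nat \<Rightarrow> (nat \<times> nat \<times> nat) set" where
  "primitive_index p q = {(i, a, b). 1 \<le> i \<and> 1 \<le> a \<and> a \<le> p * i \<and> 1 \<le> b \<and> b \<le> q * i \<and>
     gcd i (gcd a b) = 1}"

definition unit_class :: "nat \<Rightarrow> nat \<Rightarrow> nat \<times> nat \<times> nat \<Rightarrow> real mat set" where
  "unit_class p q = (\<lambda>(i, a, b). id_class (matrix_unit (p * i) (q * i) a b))"

lemma matrix_unit_mats_ratio:
  assumes "0 < p" "0 < q" "0 < i"
  shows "matrix_unit (p * i) (q * i) c d \<in> mats_ratio (of_nat p / of_nat q)"
  using assms by (intro mats_ratioI) auto

lemma unit_class_carrier:
  assumes "0 < p" "0 < q" "0 < i"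
  shows "unit_class p q (i, c, d) \<in> carrier (Sigma_space (of_nat p / of_nat q))"
  using matrix_unit_mats_ratio[OF assms] by (auto simp: unit_class_def carrier_Sigma_space)

lemma primitive_unit_classes_carrier:
  assumes "0 < p" "0 < q"
  shows "unit_class p q ` primitive_index p q \<subseteq> carrier (Sigma_space (of_nat p / of_nat q))"
  using unit_class_carrier[OF assms] by (auto simp: primitive_index_def)

lemma class_fun_unit_class:
  assumes "0 < p" "0 < q" "0 < i"
  shows "class_fun (unit_class p q (i, c, d)) = square_fun (matrix_unit (p * i) (q * i) c d)"
  using class_fun_id_class[OF matrix_unit_mats_ratio[OF assms]] by (simp add: unit_class_def)

lemma gcd_block:
  fixes i j1 j2 c d :: nat
  shows "gcd i (gcd (c * i + j1) (d * i + j2)) = gcd i (gcd j1 j2)"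
proof -
  have "gcd i (gcd (c * i + j1) (d * i + j2)) = gcd (gcd i (c * i + j1)) (gcd i (d * i + j2))"
    by (metis gcd.assoc gcd.left_commute gcd_idem_nat)
  also have "\<dots> = gcd (gcd i j1) (gcd i j2)"
    by (simp only: gcd_add_mult)
  also have "\<dots> = gcd i (gcd j1 j2)"
    by (metis gcd.assoc gcd.left_commute gcd_idem_nat)
  finally show ?thesis .
qed

lemma block_index:
  fixes a i p :: nat
  assumes "1 \<le> a" "a \<le> p * i"
  obtains k j where "1 \<le> k" "k \<le> p" "1 \<le> j" "j \<le> i" "a = (k - 1) * i + j"
proof
  have "a - 1 < p * i" using assms by linarith
  note dm = div_mod_less_mult[OF this]
  show "(a - 1) div i + 1 \<le> p" "(a - 1) mod i + 1 \<le> i" using dm by auto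
  show "a = ((a - 1) div i + 1 - 1) * i + ((a - 1) mod i + 1)"
    using assms by simp
qed auto

lemma block_index_bounds:
  fixes i p :: nat
  assumes "1 \<le> k" "k \<le> p" "1 \<le> j" "j \<le> i"
  shows "1 \<le> (k - 1) * i + j" "(k - 1) * i + j \<le> p * i"
proof -
  have "(k - 1) * i + j \<le> (k - 1) * i + i" using assms by simp
  also have "\<dots> = k * i" using assms by (cases k) simp_all
  also have "\<dots> \<le> p * i" using assms by simp
  finally show "(k - 1) * i + j \<le> p * i" .
qed (use assms in simp)

text \<open>The position \<open>(j1, j2)\<close> within block \<open>(k, l)\<close> becomes the position \<open>(a, b)\<close> with
  \<open>a = (k - 1) i + j1\<close> and \<open>b = (l - 1) i + j2\<close>, which is congruent to it modulo \<open>i\<close>, so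
  that the gcd is the same. In \<^const>\<open>D_set\<close>, where \<open>j1 = j2\<close>, the gcd collapses to that of two
  numbers; in \<^const>\<open>N_set\<close>, the bound \<open>2 \<le> i\<close> follows from \<open>j1 \<noteq> j2\<close>.\<close>

lemma D_N_eq_unit_class:
  "D_set p q \<union> N_set p q = unit_class p q ` primitive_index p q"
proof (intro equalityI subsetI)
  let ?P = "\<lambda>i j1 j2 k l. 1 \<le> k \<and> k \<le> p \<and> 1 \<le> l \<and> l \<le> q \<and> 1 \<le> j1 \<and> j1 \<le> i \<and>
    1 \<le> j2 \<and> j2 \<le> i \<and> gcd i (gcd j1 j2) = 1"
  {
    fix X assume "X \<in> D_set p q \<union> N_set p q"
    then obtain i j1 j2 k l where X: "X = id_class (matrix_unit p q k l \<otimes>\<^sub>K matrix_unit i i j1 j2)"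
      and P: "?P i j1 j2 k l"
      unfolding D_set_def N_set_def by (elim UnE CollectE exE conjE) force+
    let ?t = "(i, (k - 1) * i + j1, (l - 1) * i + j2)"
    have "?t \<in> primitive_index p q"
      using P block_index_bounds[of k p j1 i] block_index_bounds[of l q j2 i]
      by (simp add: primitive_index_def gcd_block)
    moreover have "X = unit_class p q ?t"
      using P by (simp add: X unit_class_def kronecker_matrix_unit)
    ultimately show "X \<in> unit_class p q ` primitive_index p q" by blast
  next
    fix X assume "X \<in> unit_class p q ` primitive_index p q"
    then obtain i a b where X: "X = id_class (matrix_unit (p * i) (q * i) a b)"
      and t: "1 \<le> a" "a \<le> p * i" "1 \<le> b" "b \<le> q * i" "gcd i (gcd a b) = 1"
      by (auto simp: unit_class_def primitive_index_def)
    from block_index[OF t(1,2)] obtain k j1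
      where k: "1 \<le> k" "k \<le> p" "1 \<le> j1" "j1 \<le> i" "a = (k - 1) * i + j1" .
    from block_index[OF t(3,4)] obtain l j2
      where l: "1 \<le> l" "l \<le> q" "1 \<le> j2" "j2 \<le> i" "b = (l - 1) * i + j2" .
    have g: "gcd i (gcd j1 j2) = 1" using t(5) k(5) l(5) by (simp add: gcd_block)
    have X': "X = id_class (matrix_unit p q k l \<otimes>\<^sub>K matrix_unit i i j1 j2)"
      using k l by (simp add: X kronecker_matrix_unit)
    show "X \<in> D_set p q \<union> N_set p q"
    proof (cases "j1 = j2")
      case True
      then have "X \<in> D_set p q"
        unfolding D_set_def using X' k l g by fastforce
      then show ?thesis ..
    next
      case False
      then have "2 \<le> i" using k l by linarith
      then have "X \<in> N_set p q"
        unfolding N_set_def using X' k l g False by fastforce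
      then show ?thesis ..
    qed
  }
qed

text \<open>This is uniqueness of the representation in lowest terms, for a pair of fractions with a
  common denominator.\<close>

lemma primitive_index_corner_inj:
  fixes i a b i' a' b' :: nat
  assumes "0 < p" "0 < q" "0 < i" "0 < i'" "gcd i (gcd a b) = 1" "gcd i' (gcd a' b') = 1"
    and corner: "real a / real (p * i) = real a' / real (p * i')"
      "real b / real (q * i) = real b' / real (q * i')"
  shows "(i, a, b) = (i', a', b')"
proof -
  have "real (a * i') = real (a' * i)" "real (b * i') = real (b' * i)"
    using assms(1-4) corner by (simp_all add: field_simps)
  then have cross: "a * i' = a' * i" "b * i' = b' * i" by (simp_all only: of_nat_eq_iff)
  have dvd: "u dvd v" if "gcd u (gcd c d) = 1" "c * v = c' * u" "d * v = d' * u"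
    for u v c d c' d' :: nat
  proof -
    have "u dvd gcd (u * v) (gcd (c * v) (d * v))"
      using that by simp
    also have "\<dots> = gcd u (gcd c d) * v"
      by (simp add: gcd_mult_distrib_nat mult.commute[of _ v])
    finally show ?thesis using that by simp
  qed
  have "i = i'"
    using dvd[OF assms(5) cross] dvd[OF assms(6) cross[symmetric]] by (rule dvd_antisym)
  with cross \<open>0 < i\<close> show ?thesis by simp
qed

text \<open>Dividing \<open>(N, a, b)\<close> by \<open>s = gcd N (gcd a b)\<close> gives a primitive index. Its segment has the same
  end and consists of \<open>s\<close> pieces at level \<open>N\<close>, the last of which is the given unit; the induction
  hypothesis covers the others.\<close>

lemma unit_class_mem_span:
  assumes p: "0 < p" and q: "0 < q" and "coprime p q" and N: "0 < N"
    and a: "1 \<le> a" "a \<le> p * N" and b: "1 \<le> b" "b \<le> q * N"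
  shows "unit_class p q (N, a, b) \<in>
    LinearCombinations.module.span class_ring (Sigma_space (of_nat p / of_nat q))
      (unit_class p q ` primitive_index p q)"
  using a b
proof (induction a arbitrary: b rule: less_induct)
  case (less a)
  let ?\<mu> = "rat_of_nat p / of_nat q" and ?S = "unit_class p q ` primitive_index p q"
  interpret function_model "Sigma_space ?\<mu>" class_fun
    using assms by (intro function_model_Sigma_space)
  note S = primitive_unit_classes_carrier[OF p q]
  define s where "s = gcd N (gcd a b)"
  have "0 < s" using N by (simp add: s_def)
  obtain i a' b' where eqs: "N = i * s" "a = a' * s" "b = b' * s"
  proof
    have "s dvd N" "s dvd a" "s dvd b"
      unfolding s_def by (meson dvd_trans gcd_dvd1 gcd_dvd2)+
    then show "N = N div s * s" "a = a div s * s" "b = b div s * s"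
      by (simp_all only: dvd_div_mult_self)
  qed
  have "s * gcd i (gcd a' b') = gcd N (gcd a b)"
    unfolding eqs by (simp only: gcd_mult_distrib_nat mult.commute[of s])
  then have "s * gcd i (gcd a' b') = s" by (simp only: s_def)
  then have prim: "gcd i (gcd a' b') = 1" using \<open>0 < s\<close> by simp
  have pos: "0 < i" "1 \<le> a'" "1 \<le> b'" using N less.prems eqs by (auto intro!: gr0I simp: Suc_le_eq)
  have "a' * s \<le> (p * i) * s" "b' * s \<le> (q * i) * s"
    using less.prems by (simp_all add: eqs mult.assoc)
  then have "a' \<le> p * i" "b' \<le> q * i" using \<open>0 < s\<close> by simp_all
  then have prim_mem: "unit_class p q (i, a', b') \<in> ?S"
    using prim pos by (auto simp: primitive_index_def)
  \<comment> \<open>the primitive segment with coefficient \<open>1\<close>, and its pieces other than the last with \<open>-1\<close>\<close>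
  let ?w = "\<lambda>r. if r = 0 then unit_class p q (i, a', b') else unit_class p q (N, a - r, b - r)"
  show ?case
  proof (rule submodule_memI[where J = "{..<s}" and w = ?w and c = "\<lambda>r. if r = 0 then 1 else -1"])
    show "submodule class_ring (span ?S) (Sigma_space ?\<mu>)"
      using S by (rule span_is_submodule)
    show "unit_class p q (N, a, b) \<in> carrier (Sigma_space ?\<mu>)"
      using p q N by (rule unit_class_carrier)
  next
    fix r assume "r \<in> {..<s}"
    then have r: "r < s" by simp
    have "s \<le> a" "s \<le> b" using pos by (simp_all add: eqs)
    then have "r \<noteq> 0 \<Longrightarrow> unit_class p q (N, a - r, b - r) \<in> span ?S"
      using r less.prems by (intro less.IH) auto
    then show "?w r \<in> span ?S"
      using prim_mem in_own_span[OF S] by auto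
  next
    fix z
    let ?F = "\<lambda>r. square_fun (matrix_unit (p * N) (q * N) (a - r) (b - r)) z"
    note cf = class_fun_unit_class[OF p q]
    have "square_fun (matrix_unit (p * i) (q * i) a' b') z = (\<Sum>r<s. ?F r)"
      using square_fun_matrix_unit_refine[of "p * i" "q * i" s a' b' z] p q pos \<open>0 < s\<close>
      by (simp add: eqs mult.assoc)
    then have head: "class_fun (unit_class p q (i, a', b')) z = ?F 0 + (\<Sum>r\<in>{..<s} - {0}. ?F r)"
      using \<open>0 < s\<close> pos by (simp add: cf sum.remove[of _ 0])
    have "(\<Sum>r<s. (if r = 0 then 1 else -1) * class_fun (?w r) z) =
      class_fun (unit_class p q (i, a', b')) z + (\<Sum>r\<in>{..<s} - {0}. - ?F r)"
      using \<open>0 < s\<close> N by (subst sum.remove[of _ 0]) (auto simp: cf intro!: sum.cong)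
    also have "\<dots> = ?F 0" by (simp add: head sum_negf)
    finally show "class_fun (unit_class p q (N, a, b)) z =
        (\<Sum>r<s. (if r = 0 then 1 else -1) * class_fun (?w r) z)"
      using N by (simp add: cf)
  qed simp
qed

lemma class_mem_span_units:
  assumes p: "0 < p" and q: "0 < q" and co: "coprime p q"
    and A: "A \<in> mats_ratio (of_nat p / of_nat q)"
  shows "id_class A \<in>
    LinearCombinations.module.span class_ring (Sigma_space (of_nat p / of_nat q))
      (unit_class p q ` primitive_index p q)"
proof -
  let ?\<mu> = "rat_of_nat p / of_nat q" and ?S = "unit_class p q ` primitive_index p q"
  interpret function_model "Sigma_space ?\<mu>" class_fun
    using assms by (intro function_model_Sigma_space)
  note S = primitive_unit_classes_carrier[OF p q]
  have "0\<^sub>m p q \<in> mats_ratio ?\<mu>" using p q by (intro mats_ratioI[of _ _ 1]) auto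
  \<comment> \<open>by coprimality, the size of \<open>A\<close> is a multiple of \<open>p \<times> q\<close>\<close>
  from mats_ratio_cross[OF A this] have cross: "dim_row A * q = p * dim_col A" by simp
  then have "p dvd dim_row A * q" by simp
  then obtain N where row: "dim_row A = p * N"
    using co by (metis coprime_dvd_mult_left_iff dvdE)
  with cross p have col: "dim_col A = q * N" by (auto simp: mult.commute)
  note pos = mats_ratio_pos[OF A]
  with row have N: "0 < N" by auto
  show ?thesis
  proof (rule submodule_memI[where J = "{..<p * N} \<times> {..<q * N}" and c = "\<lambda>r. A $$ r"
        and w = "\<lambda>(i, j). unit_class p q (N, i + 1, j + 1)"])
    show "submodule class_ring (span ?S) (Sigma_space ?\<mu>)"
      using S by (rule span_is_submodule)
    show "id_class A \<in> carrier (Sigma_space ?\<mu>)"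
      using A by (simp add: carrier_Sigma_space)
  next
    fix r assume "r \<in> {..<p * N} \<times> {..<q * N}"
    then show "(case r of (i, j) \<Rightarrow> unit_class p q (N, i + 1, j + 1)) \<in> span ?S"
      using unit_class_mem_span[OF p q co N] by auto
  next
    fix z
    show "class_fun (id_class A) z = (\<Sum>r\<in>{..<p * N} \<times> {..<q * N}.
        A $$ r * class_fun (case r of (i, j) \<Rightarrow> unit_class p q (N, i + 1, j + 1)) z)"
      using square_fun_matrix_units[OF pos(2,3), of z]
      by (simp add: row col class_fun_id_class[OF A] class_fun_unit_class[OF p q N]
          case_prod_unfold)
  qed simp
qed

theorem theorem15:
  fixes \<mu> :: rat and p q :: nat
  assumes "0 < p" and "0 < q" and "coprime p q"
    and "\<mu> = of_nat p / of_nat q"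
  shows "vectorspace (class_ring :: real ring) (Sigma_space \<mu>) \<and>
    countable (D_set p q \<union> N_set p q) \<and>
    infinite (D_set p q \<union> N_set p q) \<and>
    vectorspace.basis (class_ring :: real ring) (Sigma_space \<mu>) (D_set p q \<union> N_set p q)"
proof -
  let ?I = "primitive_index p q" and ?f = "unit_class p q"
  interpret function_model "Sigma_space \<mu>" class_fun
    unfolding assms(4) using assms(1-3) by (rule function_model_Sigma_space)
  have carrier: "?f ` ?I \<subseteq> carrier (Sigma_space \<mu>)"
    unfolding assms(4) using assms(1,2) by (rule primitive_unit_classes_carrier)
  \<comment> \<open>evaluation points are the ends of the segments, ranked by abscissa\<close>
  define pt where "pt = (\<lambda>(i, a, b). (real a / real (p * i), real b / real (q * i)))"
  note cf = class_fun_unit_class[OF assms(1,2)]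
  have diag: "class_fun (?f t) (pt t) \<noteq> 0" if "t \<in> ?I" for t
  proof -
    obtain i a b where t: "t = (i, a, b)" by (cases t)
    with that have "0 < i" "1 \<le> a" "a \<le> p * i" "1 \<le> b" "b \<le> q * i"
      by (auto simp: primitive_index_def)
    then show ?thesis
      unfolding t pt_def prod.case by (subst cf, simp, subst square_fun_matrix_unit_corner) auto
  qed
  have upper: "t = u \<or> fst (pt t) < fst (pt u)"
    if "t \<in> ?I" "u \<in> ?I" "class_fun (?f u) (pt t) \<noteq> 0" for t u
  proof -
    obtain i a b i' a' b' where tu: "t = (i, a, b)" "u = (i', a', b')" by (cases t, cases u)
    with that have i: "0 < i" "0 < i'" and g: "gcd i (gcd a b) = 1" "gcd i' (gcd a' b') = 1"
      by (auto simp: primitive_index_def)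
    have "0 < p * i'" "0 < q * i'" using assms i by auto
    from square_fun_matrix_unit_nonzero[OF this]
      that(3)[unfolded tu pt_def prod.case cf[OF i(2)]]
    have "fst (pt t) < fst (pt u) \<or>
        real a / real (p * i) = real a' / real (p * i') \<and>
        real b / real (q * i) = real b' / real (q * i')"
      by (auto simp: pt_def tu)
    then show ?thesis
      using primitive_index_corner_inj[OF assms(1,2) i g] tu by auto
  qed
  note indep = lin_indpt_triangular[OF carrier diag upper]
  \<comment> \<open>position \<open>(1, 1)\<close> is primitive at every level\<close>
  have "infinite ?I"
  proof
    assume "finite ?I"
    moreover have "(\<lambda>i. (Suc i, 1, 1)) ` UNIV \<subseteq> ?I"
      using assms by (auto simp: primitive_index_def Suc_le_eq)
    ultimately have "finite (range (\<lambda>i. (Suc i, 1 :: nat, 1 :: nat)))"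
      by (rule finite_subset[rotated])
    then show False by (simp add: finite_image_iff inj_on_def)
  qed
  then have "infinite (?f ` ?I)" using indep(1) by (simp add: finite_image_iff)
  moreover have "countable (?f ` ?I)" by simp
  moreover have "basis (?f ` ?I)"
    unfolding basis_def
  proof (intro conjI)
    show "span (?f ` ?I) = carrier (Sigma_space \<mu>)"
      using span_is_subset2[OF carrier] class_mem_span_units[OF assms(1-3)]
      by (auto simp: carrier_Sigma_space assms(4))
  qed (use indep carrier in auto)
  ultimately show ?thesis
    unfolding D_N_eq_unit_class using vectorspace by blast
qed

end
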